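(* Let $G$ be a finite simple undirected graph. The multivariate independence polynomial $I(G)$ is same-phase stable if and only if $G$ is claw-free.
   Context: For a finite simple undirected graph $G=(V,E)$, the multivariate independence polynomial is $I(G)(\mathbf{x}) := \sum_{S\subseteq V,\ S\text{ independent}} \prod_{v\in S} x_v$, a polynomial in the variables $(x_v)_{v\in V}$ (the empty set is independent and contributes $1$). A polynomial $p\in\mathbb{R}[z_1,\dots,z_n]$ is same-phase stable if for every $\mathbf{t}=(t_1,\dots,t_n)$ with all $t_i\ge 0$, the univariate polynomial $p(\mathbf{t}z):=p(t_1z,\dots,t_nz)$ is real-rooted (all its complex roots are real; the zero polynomial is also considered real-rooted). A claw is the complete bipartite graph $K_{1,3}$; $G$ is claw-free if it has no induced subgraph isomorphic to a claw. *)

theory Defs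
  imports
    "HOL-Analysis.Analysis"
    "HOL-Library.Poly_Mapping"
    "HOL-Computational_Algebra.Polynomial"
    "Graph_Theory.Graph_Theory"
begin

text \<open>
  A finite simple undirected graph is rendered as \<open>graph G\<close> from \<open>Graph_Theory\<close>: a finite
  loop-free symmetric digraph without parallel arcs, each undirected edge being a pair of
  opposite arcs.
\<close>

definition independent_set :: "('a, 'b) pre_digraph \<Rightarrow> 'a set \<Rightarrow> bool" where
  "independent_set G S \<longleftrightarrow> S \<subseteq> verts G \<and> (\<forall>u\<in>S. \<forall>v\<in>S. (u, v) \<notin> arcs_ends G)"

text \<open>
  \<open>K\<^bsub>1,3\<^esub> H\<close> is a predicate on \<open>H\<close> that does not fix the vertices, so it already says that \<open>H\<close>
  is isomorphic to the complete bipartite graph.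
\<close>

definition claw_free :: "('a, 'b) pre_digraph \<Rightarrow> bool" where
  "claw_free G \<longleftrightarrow> \<not> (\<exists>H. induced_subgraph H G \<and> K\<^bsub>1,3\<^esub> H)"

text \<open>
  Multivariate polynomials in variables indexed by \<open>'v\<close>: a monomial is a finitely supported
  exponent function, a polynomial a finitely supported map from monomials to coefficients.
  Ring operations are those of \<open>Poly_Mapping\<close> (convolution product).
\<close>

type_synonym ('v, 'c) mv_poly = "('v \<Rightarrow>\<^sub>0 nat) \<Rightarrow>\<^sub>0 'c"

definition mv_var :: "'v \<Rightarrow> ('v, 'c::zero_neq_one) mv_poly" where
  "mv_var v = Poly_Mapping.single (Poly_Mapping.single v 1) 1"

definition independence_poly :: "('a, 'b) pre_digraph \<Rightarrow> ('a, real) mv_poly" where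
  "independence_poly G = (\<Sum>S | independent_set G S. \<Prod>v\<in>S. mv_var v)"

text \<open>The univariate polynomial \<open>p(t z)\<close>, obtained by substituting \<open>t v * z\<close> for each variable \<open>v\<close>.\<close>

definition ray_poly :: "('v, real) mv_poly \<Rightarrow> ('v \<Rightarrow> real) \<Rightarrow> real poly" where
  "ray_poly p t =
     (\<Sum>m\<in>Poly_Mapping.keys p. smult (Poly_Mapping.lookup p m)
        (\<Prod>v\<in>Poly_Mapping.keys m. [:0, t v:] ^ Poly_Mapping.lookup m v))"

definition real_rooted :: "real poly \<Rightarrow> bool" where
  "real_rooted q \<longleftrightarrow>
     q = 0 \<or> (\<forall>z::complex. poly (map_poly complex_of_real q) z = 0 \<longrightarrow> z \<in> \<real>)"

text \<open>The set \<open>V\<close> of variables is explicit; it is meant to contain all variables occurring in \<open>p\<close>.\<close>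

definition same_phase_stable :: "'v set \<Rightarrow> ('v, real) mv_poly \<Rightarrow> bool" where
  "same_phase_stable V p \<longleftrightarrow>
     (\<forall>t. (\<forall>v\<in>V. 0 \<le> t v) \<longrightarrow> real_rooted (ray_poly p t))"

end

theory Submission
  imports Defs
begin

text \<open>
  Let \<open>P\<^sub>U\<close> be the weighted independence polynomial of the subgraph on \<open>U\<close>. For independent sets
  \<open>A\<close>, \<open>B\<close>, the difference of their cardinalities is the sum, over the connected components \<open>C\<close> of
  the symmetric difference of \<open>A\<close> and \<open>B\<close>, of the imbalance between the two sides of the bipartite
  graph \<open>C\<close>. Summing over all \<open>A\<close>, \<open>B\<close> and grouping by \<open>C\<close> gives a Christoffel-Darboux identity
  (in the spirit of Bencs): \<open>x P\<^sub>U'(x) P\<^sub>U(y) - y P\<^sub>U(x) P\<^sub>U'(y)\<close> is the sum over connected \<open>C\<close> of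
  a factor depending on \<open>C\<close> times \<open>P\<^sub>W(x) P\<^sub>W(y)\<close>, where \<open>W = U - N[C]\<close>. Without claws the two sides
  of \<open>C\<close> differ by at most one vertex, so for \<open>y\<close> the conjugate of \<open>x\<close> that factor is \<open>x - y\<close> times a
  nonnegative number. A nonreal zero \<open>x\<close> of \<open>P\<^sub>U\<close> would therefore make every summand vanish; the
  summands of single vertices contradict this by induction on \<open>U\<close>.

  A claw whose vertices have weight one, all other weights being zero, gives the cubic
  \<open>(1 + z)\<^sup>3 + z\<close>, which has a nonreal root.
\<close>

section \<open>Independent sets, connected sets and components of a symmetric irreflexive
  relation\<close>

locale sym_irrefl_rel =
  fixes E :: "('a \<times> 'a) set"
  assumes E_sym: "(u, v) \<in> E \<Longrightarrow> (v, u) \<in> E"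
    and E_irrefl: "(v, v) \<notin> E"
begin

definition indep :: "'a set \<Rightarrow> bool" where
  "indep S \<longleftrightarrow> (\<forall>u\<in>S. \<forall>v\<in>S. (u, v) \<notin> E)"

definition indep_subsets :: "'a set \<Rightarrow> 'a set set" where
  "indep_subsets U = {S. S \<subseteq> U \<and> indep S}"

text \<open>A proper 2-colouring of \<open>C\<close> is recorded by its first colour class. A
  connected bipartite \<open>C\<close> has exactly two of them, \<open>S\<close> and
  \<open>C - S\<close>; a \<open>C\<close> that is not bipartite has none.\<close>

definition bipartition_sides :: "'a set \<Rightarrow> 'a set set" where
  "bipartition_sides C = {S. S \<subseteq> C \<and> indep S \<and> indep (C - S)}"

text \<open>Connectedness is encoded by cuts instead of paths: the later arguments always hold a
  proper nonempty part of \<open>C\<close> and need an edge leaving it.\<close>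

definition conn :: "'a set \<Rightarrow> bool" where
  "conn C \<longleftrightarrow> C \<noteq> {} \<and> (\<forall>D\<subseteq>C. D \<noteq> {} \<and> D \<noteq> C \<longrightarrow> (\<exists>u\<in>D. \<exists>v\<in>C - D. (u, v) \<in> E))"

definition comps :: "'a set \<Rightarrow> 'a set set" where
  "comps W = {C. C \<subseteq> W \<and> conn C \<and> (\<forall>u\<in>C. \<forall>v\<in>W - C. (u, v) \<notin> E)}"

text \<open>The form as a signed sum makes it additive over disjoint \<open>C\<close>, and it allows
  \<open>S\<close> to reach outside \<open>C\<close>, so that a fixed \<open>S\<close> can be tested
  against every component.\<close>

definition balance :: "'a set \<Rightarrow> 'a set \<Rightarrow> int" where
  "balance S C = (\<Sum>v\<in>C. if v \<in> S then 1 else - 1)"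

lemma finite_indep_subsets: "finite U \<Longrightarrow> finite (indep_subsets U)"
  by (auto simp: indep_subsets_def)

lemma conn_singleton: "conn {v}"
  by (auto simp: conn_def subset_singleton_iff)

lemma balance_eq_card:
  assumes "finite C" "S \<subseteq> C"
  shows "balance S C = int (card S) - int (card (C - S))"
proof -
  have "balance S C = (\<Sum>v\<in>S. if v \<in> S then 1 else - 1) + (\<Sum>v\<in>C - S. if v \<in> S then 1 else - 1)"
    unfolding balance_def using assms by (subst sum.subset_diff[of S C]) auto
  then show ?thesis by simp
qed

text \<open>The vertices of \<open>A \<inter> B\<close> cancel in the difference of the two
  cardinalities.\<close>

lemma balance_symm_diff:
  assumes "finite A" "finite B"
  shows "balance A ((A - B) \<union> (B - A)) = int (card A) - int (card B)"
proof -
  have "balance A ((A - B) \<union> (B - A)) = int (card (A - B)) - int (card (B - A))"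
    unfolding balance_def using assms by (subst sum.union_disjoint) auto
  moreover have "card A = card (A - B) + card (A \<inter> B)" "card B = card (B - A) + card (A \<inter> B)"
    using assms by (metis card_Diff_subset_Int card_mono inf_le1 le_add_diff_inverse2 finite_Int)
      (metis assms card_Diff_subset_Int card_mono inf_le1 inf_commute le_add_diff_inverse2 finite_Int)
  ultimately show ?thesis by simp
qed

text \<open>If one component were not contained in the other, their intersection would be a proper
  nonempty part of it, and an edge leaving this part would leave the other component too.\<close>

lemma comps_eqI:
  assumes C: "C \<in> comps W" and C': "C' \<in> comps W" and ne: "C \<inter> C' \<noteq> {}"
  shows "C = C'"
proof -
  have sub: "A \<subseteq> B" if A: "A \<in> comps W" and B: "B \<in> comps W" and ne: "A \<inter> B \<noteq> {}" for A B
  proof (rule ccontr)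
    assume "\<not> A \<subseteq> B"
    then have "A \<inter> B \<noteq> A" by blast
    moreover have "conn A" using A by (simp add: comps_def)
    ultimately obtain u v where uv: "u \<in> A \<inter> B" "v \<in> A - A \<inter> B" "(u, v) \<in> E"
      using ne unfolding conn_def by (metis Int_lower1)
    then show False using A B unfolding comps_def by blast
  qed
  from sub[OF C C' ne] sub[OF C' C] ne show ?thesis by blast
qed

lemma Union_comps:
  assumes "finite W"
  shows "\<Union>(comps W) = W"
proof
  show "\<Union>(comps W) \<subseteq> W" by (auto simp: comps_def)
next
  show "W \<subseteq> \<Union>(comps W)"
  proof
    fix v assume v: "v \<in> W"
    define P where "P C \<longleftrightarrow> v \<in> C \<and> C \<subseteq> W \<and> (\<forall>u\<in>C. \<forall>w\<in>W - C. (u, w) \<notin> E)" for C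
    have "P W" using v by (auto simp: P_def)
    \<comment> \<open>The component of \<open>v\<close> is found as a smallest set around
      \<open>v\<close> that no edge leaves within \<open>W\<close>.\<close>
    then obtain C where C: "P C" and min: "\<And>D. P D \<Longrightarrow> card C \<le> card D"
      using ex_has_least_nat[of P W card] by blast
    have finC: "finite C" using C assms by (auto simp: P_def intro: finite_subset)
    have "conn C"
      unfolding conn_def
    proof (intro conjI allI impI)
      show "C \<noteq> {}" using C by (auto simp: P_def)
    next
      fix D assume D: "D \<subseteq> C" "D \<noteq> {} \<and> D \<noteq> C"
      show "\<exists>u\<in>D. \<exists>w\<in>C - D. (u, w) \<in> E"
      proof (rule ccontr)
        assume neg: "\<not> ?thesis"
        \<comment> \<open>If no edge joins \<open>D\<close> to \<open>C - D\<close>, then by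
          symmetry both halves are closed, and the one containing \<open>v\<close> contradicts
          minimality.\<close>
        define D' where "D' = (if v \<in> D then D else C - D)"
        have "D' \<subset> C" using D by (auto simp: D'_def)
        then have "card D' < card C" using finC by (rule psubset_card_mono[rotated])
        moreover have "P D'"
          using C D(1) neg E_sym unfolding P_def D'_def by (cases "v \<in> D") (simp, blast)+
        ultimately show False using min[of D'] by simp
      qed
    qed
    then show "v \<in> \<Union>(comps W)" using C by (auto simp: comps_def P_def)
  qed
qed

lemma balance_eq_sum_comps:
  assumes "finite W"
  shows "balance S W = (\<Sum>C\<in>comps W. balance S C)"
proof -
  have "balance S (\<Union>(comps W)) = (\<Sum>C\<in>comps W. balance S C)"
    unfolding balance_def
  proof (subst sum.Union_disjoint)
    show "\<forall>A\<in>comps W. finite A" using assms by (auto simp: comps_def intro: finite_subset)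
    show "\<forall>A\<in>comps W. \<forall>B\<in>comps W. A \<noteq> B \<longrightarrow> A \<inter> B = {}" using comps_eqI by blast
  qed auto
  then show ?thesis using Union_comps[OF assms] by simp
qed

text \<open>On a component \<open>C\<close> of the symmetric difference, \<open>A\<close> and
  \<open>B\<close> are complementary, so \<open>S = A \<inter> C\<close> determines both there.
  Outside \<open>C\<close> they can be any independent sets avoiding the neighbours of
  \<open>C\<close>, chosen independently of each other.\<close>

lemma bij_betw_pairs_with_component:
  assumes C: "C \<subseteq> U" "conn C"
  defines "W \<equiv> U - (C \<union> E `` C)"
  shows "bij_betw (\<lambda>(S, A, B). (A \<union> S, B \<union> (C - S)))
           (bipartition_sides C \<times> indep_subsets W \<times> indep_subsets W)
           {(A, B). A \<in> indep_subsets U \<and> B \<in> indep_subsets U \<and> C \<in> comps ((A - B) \<union> (B - A))}"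
proof (rule bij_betw_byWitness[where f' = "\<lambda>(A, B). (A \<inter> C, A - C, B - C)"])
  show "\<forall>p\<in>bipartition_sides C \<times> indep_subsets W \<times> indep_subsets W.
          (\<lambda>(A, B). (A \<inter> C, A - C, B - C)) ((\<lambda>(S, A, B). (A \<union> S, B \<union> (C - S))) p) = p"
    unfolding bipartition_sides_def indep_subsets_def W_def by auto
next
  show "\<forall>p\<in>{(A, B). A \<in> indep_subsets U \<and> B \<in> indep_subsets U \<and> C \<in> comps ((A - B) \<union> (B - A))}.
          (\<lambda>(S, A, B). (A \<union> S, B \<union> (C - S))) ((\<lambda>(A, B). (A \<inter> C, A - C, B - C)) p) = p"
    unfolding comps_def by auto
next
  show "(\<lambda>(S, A, B). (A \<union> S, B \<union> (C - S))) ` (bipartition_sides C \<times> indep_subsets W \<times> indep_subsets W)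
     \<subseteq> {(A, B). A \<in> indep_subsets U \<and> B \<in> indep_subsets U \<and> C \<in> comps ((A - B) \<union> (B - A))}"
  proof clarify
    fix S A B
    assume S: "S \<in> bipartition_sides C" and A: "A \<in> indep_subsets W" and B: "B \<in> indep_subsets W"
    have ind: "X \<union> Y \<in> indep_subsets U" if "X \<in> indep_subsets W" "Y \<subseteq> C" "indep Y" for X Y
      using that C(1) E_sym unfolding indep_subsets_def indep_def W_def by blast
    have dis: "A \<inter> C = {}" "B \<inter> C = {}" using A B by (auto simp: indep_subsets_def W_def)
    have "((A \<union> S) - (B \<union> (C - S))) \<union> ((B \<union> (C - S)) - (A \<union> S)) = C \<union> ((A - B) \<union> (B - A))"
      using dis S unfolding bipartition_sides_def by blast
    moreover have "C \<in> comps (C \<union> ((A - B) \<union> (B - A)))"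
      using C(2) A B unfolding comps_def indep_subsets_def W_def by blast
    ultimately show "A \<union> S \<in> indep_subsets U \<and> B \<union> (C - S) \<in> indep_subsets U
        \<and> C \<in> comps ((A \<union> S - (B \<union> (C - S))) \<union> (B \<union> (C - S) - (A \<union> S)))"
      using ind[OF A, of S] ind[OF B, of "C - S"] S by (auto simp: bipartition_sides_def)
  qed
next
  show "(\<lambda>(A, B). (A \<inter> C, A - C, B - C)) `
     {(A, B). A \<in> indep_subsets U \<and> B \<in> indep_subsets U \<and> C \<in> comps ((A - B) \<union> (B - A))}
     \<subseteq> bipartition_sides C \<times> indep_subsets W \<times> indep_subsets W"
  proof (rule image_subsetI)
    fix p
    assume p: "p \<in> {(A, B). A \<in> indep_subsets U \<and> B \<in> indep_subsets U \<and> C \<in> comps ((A - B) \<union> (B - A))}"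
    obtain A B where p_eq: "p = (A, B)" by (cases p)
    have A: "A \<in> indep_subsets U" and B: "B \<in> indep_subsets U"
      and comp: "C \<in> comps ((A - B) \<union> (B - A))"
      using p by (simp_all add: p_eq)
    have sub: "C \<subseteq> (A - B) \<union> (B - A)"
      and closed: "\<And>u v. u \<in> C \<Longrightarrow> v \<in> (A - B) \<union> (B - A) \<Longrightarrow> v \<notin> C \<Longrightarrow> (u, v) \<notin> E"
      using comp unfolding comps_def by auto
    have iA: "A \<subseteq> U" "\<And>u v. u \<in> A \<Longrightarrow> v \<in> A \<Longrightarrow> (u, v) \<notin> E"
      and iB: "B \<subseteq> U" "\<And>u v. u \<in> B \<Longrightarrow> v \<in> B \<Longrightarrow> (u, v) \<notin> E"
      using A B unfolding indep_subsets_def indep_def by auto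
    have "A \<inter> C \<in> bipartition_sides C"
      using sub iA iB unfolding bipartition_sides_def indep_def by blast
    \<comment> \<open>A vertex of \<open>A - C\<close> or \<open>B - C\<close> adjacent to
      \<open>C\<close> would lie either in both sets, against independence, or in their symmetric
      difference, against \<open>C\<close> being a component.\<close>
    moreover have "A - C \<in> indep_subsets W" "B - C \<in> indep_subsets W"
      using sub closed iA iB unfolding indep_subsets_def indep_def W_def by blast+
    ultimately show "(\<lambda>(A, B). (A \<inter> C, A - C, B - C)) p
        \<in> bipartition_sides C \<times> indep_subsets W \<times> indep_subsets W"
      by (simp add: p_eq)
  qed
qed

section \<open>The weighted independence polynomial and the Christoffel-Darboux identity\<close>

definition weight :: "('a \<Rightarrow> real) \<Rightarrow> complex \<Rightarrow> 'a set \<Rightarrow> complex" where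
  "weight t x S = (\<Prod>v\<in>S. complex_of_real (t v) * x)"

definition ipoly :: "('a \<Rightarrow> real) \<Rightarrow> 'a set \<Rightarrow> complex \<Rightarrow> complex" where
  "ipoly t U x = (\<Sum>S\<in>indep_subsets U. weight t x S)"

text \<open>For connected bipartite \<open>C\<close> with sides of sizes \<open>m\<close> and
  \<open>n\<close> and total weight \<open>w\<close>, the product of all \<open>t v\<close>, this is
  \<open>w * (m - n) * (x^m * y^n - x^n * y^m)\<close>.\<close>

definition imbalance :: "('a \<Rightarrow> real) \<Rightarrow> 'a set \<Rightarrow> complex \<Rightarrow> complex \<Rightarrow> complex" where
  "imbalance t C x y =
     (\<Sum>S\<in>bipartition_sides C. of_int (balance S C) * weight t x S * weight t y (C - S))"

lemma weight_eq_power: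
  "weight t x S = of_real (\<Prod>v\<in>S. t v) * x ^ card S"
  unfolding weight_def by (simp add: prod.distrib)

lemma weight_union_disjoint:
  assumes "finite A" "finite B" "A \<inter> B = {}"
  shows "weight t x (A \<union> B) = weight t x A * weight t x B"
  unfolding weight_def using assms by (rule prod.union_disjoint)

text \<open>With \<open>P = ipoly t U\<close>, the left side is
  \<open>x P'(x) P(y) - y P(x) P'(y)\<close>, written without derivatives: the operator
  \<open>x d/dx\<close> multiplies \<open>weight t x A\<close> by \<open>card A\<close>.\<close>

theorem christoffel_darboux:
  assumes fin: "finite U"
  shows "(\<Sum>A\<in>indep_subsets U. \<Sum>B\<in>indep_subsets U.
            of_int (int (card A) - int (card B)) * weight t x A * weight t y B)
       = (\<Sum>C | C \<subseteq> U \<and> conn C. imbalance t C x y *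
            ipoly t (U - (C \<union> E `` C)) x * ipoly t (U - (C \<union> E `` C)) y)"
proof -
  let ?I = "indep_subsets U"
  let ?K = "{C. C \<subseteq> U \<and> conn C}"
  let ?D = "\<lambda>A B. (A - B) \<union> (B - A)"
  have finI: "finite ?I" by (rule finite_indep_subsets[OF fin])
  have finK: "finite ?K" using fin by auto
  have fs: "finite A" if "A \<subseteq> U" for A using that fin finite_subset by blast
  have "(\<Sum>A\<in>?I. \<Sum>B\<in>?I. of_int (int (card A) - int (card B)) * weight t x A * weight t y B)
      = (\<Sum>(A, B)\<in>?I \<times> ?I. \<Sum>C\<in>?K. if C \<in> comps (?D A B)
            then of_int (balance A C) * weight t x A * weight t y B else 0)"
    unfolding sum.cartesian_product
  proof (rule sum.cong[OF refl], clarify)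
    fix A B assume A: "A \<in> ?I" and B: "B \<in> ?I"
    have fAB: "finite A" "finite B" using A B fs by (auto simp: indep_subsets_def)
    \<comment> \<open>The sum over components is padded with zeros to the index set
      \<open>?K\<close>, which does not depend on \<open>A\<close> and \<open>B\<close>, so that the
      sums can be exchanged.\<close>
    have "comps (?D A B) \<subseteq> ?K" using A B by (auto simp: comps_def indep_subsets_def)
    then have K: "?K \<inter> {C. C \<in> comps (?D A B)} = comps (?D A B)" by blast
    have "int (card A) - int (card B) = (\<Sum>C\<in>comps (?D A B). balance A C)"
      using balance_eq_sum_comps[of "?D A B" A] balance_symm_diff[OF fAB] fAB by simp
    then have "of_int (int (card A) - int (card B)) * weight t x A * weight t y B
       = (\<Sum>C\<in>comps (?D A B). of_int (balance A C) * weight t x A * weight t y B)"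
      by (simp only: of_int_sum sum_distrib_right)
    also have "\<dots> = (\<Sum>C\<in>?K. if C \<in> comps (?D A B)
            then of_int (balance A C) * weight t x A * weight t y B else 0)"
      using finK K by (simp add: sum.If_cases)
    finally show "of_int (int (card A) - int (card B)) * weight t x A * weight t y B
       = (\<Sum>C\<in>?K. if C \<in> comps (?D A B)
            then of_int (balance A C) * weight t x A * weight t y B else 0)" .
  qed
  also have "\<dots> = (\<Sum>C\<in>?K. \<Sum>(A, B)\<in>?I \<times> ?I. if C \<in> comps (?D A B)
            then of_int (balance A C) * weight t x A * weight t y B else 0)"
    by (simp only: case_prod_unfold) (rule sum.swap)
  also have "\<dots> = (\<Sum>C\<in>?K. imbalance t C x y *
            ipoly t (U - (C \<union> E `` C)) x * ipoly t (U - (C \<union> E `` C)) y)"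
  proof (rule sum.cong[OF refl], clarify)
    fix C assume C: "C \<subseteq> U" "conn C"
    let ?W = "U - (C \<union> E `` C)"
    let ?J = "indep_subsets ?W"
    have "(\<Sum>(A, B)\<in>?I \<times> ?I. if C \<in> comps (?D A B)
            then of_int (balance A C) * weight t x A * weight t y B else 0)
       = (\<Sum>(A, B)\<in>{(A, B). A \<in> ?I \<and> B \<in> ?I \<and> C \<in> comps (?D A B)}.
            of_int (balance A C) * weight t x A * weight t y B)"
      using finI by (intro sum.mono_neutral_cong_right) (auto split: if_splits)
    also have "\<dots> = (\<Sum>(S, A, B)\<in>bipartition_sides C \<times> ?J \<times> ?J.
        of_int (balance (A \<union> S) C) * weight t x (A \<union> S) * weight t y (B \<union> (C - S)))"
      using sum.reindex_bij_betw[OF bij_betw_pairs_with_component[OF C],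
          of "\<lambda>(A, B). of_int (balance A C) * weight t x A * weight t y B"]
      by (simp add: case_prod_unfold)
    also have "\<dots> = (\<Sum>(S, A, B)\<in>bipartition_sides C \<times> ?J \<times> ?J.
        (of_int (balance S C) * weight t x S * weight t y (C - S)) * (weight t x A * weight t y B))"
    proof (rule sum.cong[OF refl], clarify)
      fix S A B assume S: "S \<in> bipartition_sides C" and A: "A \<in> ?J" and B: "B \<in> ?J"
      have sub: "S \<subseteq> C" "A \<inter> C = {}" "B \<inter> C = {}" "A \<subseteq> U" "B \<subseteq> U"
        using S A B by (auto simp: bipartition_sides_def indep_subsets_def)
      have "finite A" "finite B" "finite S" "finite (C - S)"
        using sub C fs by auto
      moreover have "A \<inter> S = {}" "B \<inter> (C - S) = {}" using sub by auto
      moreover have "balance (A \<union> S) C = balance S C"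
        unfolding balance_def using sub by (intro sum.cong) auto
      ultimately show "of_int (balance (A \<union> S) C) * weight t x (A \<union> S) * weight t y (B \<union> (C - S))
         = (of_int (balance S C) * weight t x S * weight t y (C - S)) * (weight t x A * weight t y B)"
        by (simp add: weight_union_disjoint mult_ac)
    qed
    also have "\<dots> = imbalance t C x y * (ipoly t ?W x * ipoly t ?W y)"
      unfolding imbalance_def ipoly_def sum_product sum.cartesian_product by (simp add: case_prod_unfold)
    finally show "(\<Sum>(A, B)\<in>?I \<times> ?I. if C \<in> comps (?D A B)
            then of_int (balance A C) * weight t x A * weight t y B else 0)
       = imbalance t C x y * ipoly t ?W x * ipoly t ?W y"
      by (simp add: mult.assoc)
  qed
  finally show ?thesis .
qed

end

section \<open>Nearly balanced bipartitions and absence of nonreal zeros without claws\<close>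

locale claw_free_rel = sym_irrefl_rel +
  assumes no_claw: "(v, a) \<in> E \<Longrightarrow> (v, b) \<in> E \<Longrightarrow> (v, c) \<in> E \<Longrightarrow> distinct [a, b, c]
    \<Longrightarrow> (a, b) \<in> E \<or> (a, c) \<in> E \<or> (b, c) \<in> E"
begin

text \<open>Three neighbours of \<open>v\<close> in an independent set would form a claw with centre
  \<open>v\<close>.\<close>

lemma card_neighbours_indep:
  assumes "finite S" "indep S"
  shows "card (S \<inter> E `` {v}) \<le> 2"
proof (rule ccontr)
  assume "\<not> ?thesis"
  then have "3 \<le> card (S \<inter> E `` {v})" by simp
  then obtain X where X: "X \<subseteq> S \<inter> E `` {v}" "card X = 3"
    by (meson obtain_subset_with_card_n)
  then obtain a b c where "X = {a, b, c}" "distinct [a, b, c]"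
    by (auto simp: card_3_iff)
  then show False using X(1) no_claw[of v a b c] assms(2) unfolding indep_def by auto
qed

text \<open>Grow a set containing all \<open>S\<close>-neighbours of its members outside \<open>S\<close>: each new vertex
  outside \<open>S\<close> already has a neighbour in the set, so it contributes at most one new member of \<open>S\<close>.\<close>

lemma card_side_le:
  assumes fin: "finite C" and C: "conn C" and S: "S \<in> bipartition_sides C"
  shows "card S \<le> card (C - S) + 1"
proof (cases "S = {}")
  case False
  then obtain s where s: "s \<in> S" by blast
  have SC: "S \<subseteq> C" "indep S" "indep (C - S)" using S by (auto simp: bipartition_sides_def)
  have finS: "finite S" using SC fin finite_subset by blast
  define P where "P D \<longleftrightarrow> D \<subseteq> C \<and> s \<in> D \<and> card (D \<inter> S) \<le> card (D - S) + 1
      \<and> (\<forall>v\<in>D - S. S \<inter> E `` {v} \<subseteq> D)" for D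
  \<comment> \<open>The start has one vertex in \<open>S\<close> and none outside, which is where
    the \<open>+ 1\<close> comes from.\<close>
  have "P {s}" using s SC by (auto simp: P_def)
  moreover have "\<And>D. P D \<Longrightarrow> card D < Suc (card C)"
    using fin by (auto simp: P_def less_Suc_eq_le intro: card_mono)
  ultimately obtain D where D: "P D" and max: "\<And>D'. P D' \<Longrightarrow> card D' \<le> card D"
    using ex_has_greatest_nat[of P "{s}" card "Suc (card C)"] by blast
  have finD: "finite D" using D fin finite_subset by (auto simp: P_def)
  have "D = C"
  proof (rule ccontr)
    assume "D \<noteq> C"
    moreover have "D \<subseteq> C" "D \<noteq> {}" using D by (auto simp: P_def)
    ultimately obtain u v where uv: "u \<in> D" "v \<in> C - D" "(u, v) \<in> E"
      using C unfolding conn_def by blast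
    \<comment> \<open>Otherwise \<open>v\<close>, a neighbour of \<open>u\<close>, would lie in
      \<open>S\<close> because \<open>C - S\<close> is independent, and the closure condition in
      \<open>P\<close> would already put it into \<open>D\<close>.\<close>
    have uS: "u \<in> S"
    proof (rule ccontr)
      assume u: "u \<notin> S"
      then have "v \<in> S" using uv \<open>D \<subseteq> C\<close> SC(3) unfolding indep_def by blast
      then show False using D u uv unfolding P_def by blast
    qed
    then have vS: "v \<notin> S" using uv SC(2) unfolding indep_def by blast
    define N where "N = S \<inter> E `` {v}"
    have uN: "u \<in> N" using uS uv E_sym by (auto simp: N_def)
    have finN: "finite N" using finS by (simp add: N_def)
    \<comment> \<open>Of the at most two \<open>S\<close>-neighbours of \<open>v\<close>, one is
      \<open>u\<close>, which belongs to \<open>D\<close> already.\<close>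
    have "card (N - {u}) \<le> 1"
      using card_neighbours_indep[OF finS SC(2), of v] uN finN by (simp add: N_def[symmetric])
    define D' where "D' = insert v (D \<union> N)"
    have "D' \<inter> S \<subseteq> (D \<inter> S) \<union> (N - {u})" using vS uv uS by (auto simp: D'_def)
    then have "card (D' \<inter> S) \<le> card ((D \<inter> S) \<union> (N - {u}))"
      using finD finN by (intro card_mono) auto
    also have "\<dots> \<le> card (D \<inter> S) + card (N - {u})" by (rule card_Un_le)
    finally have c1: "card (D' \<inter> S) \<le> card (D \<inter> S) + 1" using \<open>card (N - {u}) \<le> 1\<close> by simp
    have "D' - S = insert v (D - S)" using vS by (auto simp: D'_def N_def)
    then have c2: "card (D' - S) = card (D - S) + 1" using finD uv by simp
    have "P D'"
      using D c1 c2 uv SC(1) unfolding P_def by (auto simp: D'_def N_def)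
    moreover have "card D < card D'"
      using finD finN uv by (intro psubset_card_mono) (auto simp: D'_def)
    ultimately show False using max[of D'] by simp
  qed
  then show ?thesis using D SC(1) by (simp add: P_def Int_absorb1)
qed simp

text \<open>The complement of a side is again a side, so the one-sided bound applies to
  both.\<close>

lemma abs_balance_le_1:
  assumes "finite C" "conn C" "S \<in> bipartition_sides C"
  shows "\<bar>balance S C\<bar> \<le> 1"
proof -
  have S: "S \<subseteq> C" and "C - S \<in> bipartition_sides C"
    using assms(3) by (auto simp: bipartition_sides_def double_diff)
  then have "card (C - S) \<le> card (C - (C - S)) + 1" using card_side_le assms by blast
  then show ?thesis
    using card_side_le[OF assms] S by (simp add: balance_eq_card[OF assms(1) S] double_diff)
qed

text \<open>Exchanging the two sides pairs up the terms of the sum.\<close>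

lemma imbalance_cnj:
  assumes fin: "finite C" and C: "conn C" and t: "\<forall>v\<in>C. 0 \<le> t v"
  obtains r where "0 \<le> r" "imbalance t C z (cnj z) = (z - cnj z) * complex_of_real r"
proof -
  let ?B = "bipartition_sides C"
  let ?w = "\<Prod>v\<in>C. t v"
  have w: "0 \<le> ?w" using t by (intro prod_nonneg) auto
  have inv: "bij_betw (\<lambda>S. C - S) ?B ?B"
    by (rule bij_betw_byWitness[where f' = "\<lambda>S. C - S"]) (auto simp: bipartition_sides_def double_diff)
  have "imbalance t C z (cnj z) = (\<Sum>S\<in>?B. of_int (balance (C - S) C) * weight t z (C - S) * weight t (cnj z) (C - (C - S)))"
    unfolding imbalance_def by (rule sum.reindex_bij_betw[OF inv, symmetric])
  \<comment> \<open>Doubling the sum avoids choosing a representative of each pair of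
    \<open>S\<close> and \<open>C - S\<close>.\<close>
  then have "2 * imbalance t C z (cnj z) = 
      (\<Sum>S\<in>?B. of_int (balance S C) * weight t z S * weight t (cnj z) (C - S)
         + of_int (balance (C - S) C) * weight t z (C - S) * weight t (cnj z) (C - (C - S)))"
    unfolding sum.distrib by (simp add: imbalance_def)
  also have "\<dots> = (\<Sum>S\<in>?B. (z - cnj z) * complex_of_real
      (?w * of_int \<bar>balance S C\<bar> * (cmod z ^ 2) ^ min (card S) (card (C - S))))"
  proof (rule sum.cong[OF refl])
    fix S assume S: "S \<in> ?B"
    then have SC: "S \<subseteq> C" by (auto simp: bipartition_sides_def)
    define m n where "m = card S" and "n = card (C - S)"
    have b1: "balance S C = int m - int n"
      using balance_eq_card[OF fin SC] by (simp add: m_def n_def)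
    have b2: "balance (C - S) C = int n - int m"
      using balance_eq_card[OF fin, of "C - S"] SC by (simp add: m_def n_def double_diff)
    have "?w = (\<Prod>v\<in>S. t v) * (\<Prod>v\<in>C - S. t v)"
      using prod.subset_diff[OF SC fin, of t] by (simp add: mult.commute)
    then have "of_int (balance S C) * weight t z S * weight t (cnj z) (C - S)
         + of_int (balance (C - S) C) * weight t z (C - S) * weight t (cnj z) (C - (C - S))
       = of_real ?w * of_int (int m - int n) * (z ^ m * cnj z ^ n - z ^ n * cnj z ^ m)"
      using SC by (simp add: b1 b2 weight_eq_power double_diff algebra_simps flip: m_def n_def)
    \<comment> \<open>For \<open>m = n\<close> both sides vanish. For sizes differing by one,
      \<open>(z * cnj z) ^ min m n\<close> factors out and leaves \<open>z - cnj z\<close> up to a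
      sign, which the sign of \<open>m - n\<close> cancels.\<close>
    moreover have "of_int (int m - int n) * (z ^ m * cnj z ^ n - z ^ n * cnj z ^ m)
       = (z - cnj z) * (of_int \<bar>int m - int n\<bar> * (z * cnj z) ^ min m n)"
    proof -
      have "\<bar>int m - int n\<bar> \<le> 1" using abs_balance_le_1[OF fin C S] b1 by simp
      then consider "m = n" | "m = Suc n" | "n = Suc m" by linarith
      then show ?thesis by cases (simp_all add: power_mult_distrib algebra_simps)
    qed
    moreover have "complex_of_real (?w * of_int \<bar>balance S C\<bar> * (cmod z ^ 2) ^ min m n)
       = of_real ?w * (of_int \<bar>int m - int n\<bar> * (z * cnj z) ^ min m n)"
      unfolding b1 of_real_mult of_real_of_int_eq of_real_power[of _ "min m n"] complex_norm_square
      by (rule mult.assoc)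
    ultimately show "of_int (balance S C) * weight t z S * weight t (cnj z) (C - S)
         + of_int (balance (C - S) C) * weight t z (C - S) * weight t (cnj z) (C - (C - S))
       = (z - cnj z) * complex_of_real
      (?w * of_int \<bar>balance S C\<bar> * (cmod z ^ 2) ^ min (card S) (card (C - S)))"
      unfolding m_def[symmetric] n_def[symmetric] by (simp only: mult.assoc) (simp only: mult.left_commute)
  qed
  also have "\<dots> = (z - cnj z) * complex_of_real (\<Sum>S\<in>?B.
      ?w * of_int \<bar>balance S C\<bar> * (cmod z ^ 2) ^ min (card S) (card (C - S)))"
    by (simp only: sum_distrib_left of_real_sum)
  finally have "imbalance t C z (cnj z) = (z - cnj z) * complex_of_real ((\<Sum>S\<in>?B.
      ?w * of_int \<bar>balance S C\<bar> * (cmod z ^ 2) ^ min (card S) (card (C - S))) / 2)"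
    by (simp add: mult.commute)
  moreover have "0 \<le> (\<Sum>S\<in>?B.
      ?w * of_int \<bar>balance S C\<bar> * (cmod z ^ 2) ^ min (card S) (card (C - S))) / 2"
    using w by (intro divide_nonneg_nonneg sum_nonneg) (auto intro!: mult_nonneg_nonneg)
  ultimately show ?thesis using that by blast
qed

lemma imbalance_singleton: "imbalance t {v} x y = (x - y) * of_real (t v)"
proof -
  have "bipartition_sides {v} = {{}, {v}}"
    using E_irrefl by (auto simp: bipartition_sides_def indep_def subset_singleton_iff)
  then show ?thesis by (simp add: imbalance_def balance_def weight_def algebra_simps)
qed

lemma ipoly_cnj: "ipoly t U (cnj z) = cnj (ipoly t U z)"
  by (simp add: ipoly_def weight_def)

text \<open>At a nonreal zero the identity for \<open>z\<close> and \<open>cnj z\<close> becomes a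
  vanishing sum of nonnegative reals. By induction the polynomial of \<open>U - N[v]\<close> does
  not vanish at \<open>z\<close>, so the summand of \<open>{v}\<close> forces
  \<open>t v = 0\<close>. With all weights zero the polynomial is the constant 1.\<close>

theorem ipoly_nonzero:
  assumes "finite U" "\<forall>v\<in>U. 0 \<le> t v" "z \<notin> \<real>"
  shows "ipoly t U z \<noteq> 0"
  using assms(1,2)
proof (induction U rule: finite_psubset_induct)
  case (psubset U)
  show ?case
  proof
    assume zero: "ipoly t U z = 0"
    let ?K = "{C. C \<subseteq> U \<and> conn C}"
    let ?W = "\<lambda>C. U - (C \<union> E `` C)"
    define r where "r C = (SOME r. 0 \<le> r \<and> imbalance t C z (cnj z) = (z - cnj z) * complex_of_real r)" for C
    have r: "0 \<le> r C \<and> imbalance t C z (cnj z) = (z - cnj z) * complex_of_real (r C)" if "C \<in> ?K" for C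
    proof -
      have "finite C" "conn C" "\<forall>v\<in>C. 0 \<le> t v"
        using that psubset.prems psubset.hyps finite_subset by auto
      then show ?thesis
        unfolding r_def by (rule imbalance_cnj[of C t z]) (rule someI, blast)
    qed
    have zc: "z - cnj z \<noteq> 0" using assms(3) by (auto simp: complex_eq_iff complex_is_Real_iff)
    have finK: "finite ?K" using psubset.hyps by auto
    \<comment> \<open>Splitting \<open>card A - card B\<close> makes the double sum factor; each
      product contains the value at \<open>z\<close> or at \<open>cnj z\<close>, and both are
      zero.\<close>
    have "(\<Sum>A\<in>indep_subsets U. \<Sum>B\<in>indep_subsets U.
            of_int (int (card A) - int (card B)) * weight t z A * weight t (cnj z) B)
      = (\<Sum>A\<in>indep_subsets U. of_nat (card A) * weight t z A) * ipoly t U (cnj z)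
        - ipoly t U z * (\<Sum>B\<in>indep_subsets U. of_nat (card B) * weight t (cnj z) B)"
      unfolding ipoly_def sum_product sum_subtractf[symmetric]
      by (intro sum.cong refl) (simp add: algebra_simps)
    also have "\<dots> = 0" by (simp add: zero ipoly_cnj)
    finally have "(\<Sum>C\<in>?K. imbalance t C z (cnj z) * ipoly t (?W C) z * ipoly t (?W C) (cnj z)) = 0"
      by (simp only: christoffel_darboux[OF psubset.hyps(1)])
    also have "(\<Sum>C\<in>?K. imbalance t C z (cnj z) * ipoly t (?W C) z * ipoly t (?W C) (cnj z))
       = (\<Sum>C\<in>?K. (z - cnj z) * complex_of_real (r C * (cmod (ipoly t (?W C) z))\<^sup>2))"
      using r by (intro sum.cong refl) (simp add: ipoly_cnj complex_norm_square mult_ac del: of_real_power)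
    also have "\<dots> = (z - cnj z) * complex_of_real (\<Sum>C\<in>?K. r C * (cmod (ipoly t (?W C) z))\<^sup>2)"
      by (simp only: sum_distrib_left of_real_sum)
    finally have "(\<Sum>C\<in>?K. r C * (cmod (ipoly t (?W C) z))\<^sup>2) = 0"
      using zc by (simp del: of_real_sum)
    then have all0: "r C * (cmod (ipoly t (?W C) z))\<^sup>2 = 0" if "C \<in> ?K" for C
      using that r finK by (subst (asm) sum_nonneg_eq_0_iff) auto
    have t0: "t v = 0" if v: "v \<in> U" for v
    proof -
      have K: "{v} \<in> ?K" using v conn_singleton by auto
      have "ipoly t (?W {v}) z \<noteq> 0"
        using psubset.prems v by (intro psubset.IH) auto
      then have "r {v} = 0" using all0[OF K] by simp
      then show ?thesis using r[OF K] zc by (simp add: imbalance_singleton)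
    qed
    have "ipoly t U z = (\<Sum>S\<in>indep_subsets U. if S = {} then 1 else 0)"
      unfolding ipoly_def
    proof (rule sum.cong[OF refl])
      fix S assume "S \<in> indep_subsets U"
      then have "finite S" "\<forall>v\<in>S. t v = 0"
        using psubset.hyps t0 by (auto simp: indep_subsets_def intro: finite_subset)
      then show "weight t z S = (if S = {} then 1 else 0)"
        by (auto simp: weight_def prod_zero_iff)
    qed
    also have "\<dots> = 1"
      using finite_indep_subsets[OF psubset.hyps]
      by (simp add: indep_subsets_def indep_def)
    finally show False using zero by simp
  qed
qed

end

section \<open>Restriction of the multivariate polynomial to a ray\<close>

lemma map_poly_of_real_sum:
  "map_poly complex_of_real (\<Sum>i\<in>A. f i) = (\<Sum>i\<in>A. map_poly complex_of_real (f i))"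
  by (rule poly_eqI) (simp add: coeff_map_poly coeff_sum)

lemma map_poly_of_real_mult:
  "map_poly complex_of_real (p * q) = map_poly complex_of_real p * map_poly complex_of_real q"
  by (rule poly_eqI) (simp add: coeff_map_poly coeff_mult)

lemma map_poly_of_real_prod:
  "map_poly complex_of_real (\<Prod>i\<in>A. f i) = (\<Prod>i\<in>A. map_poly complex_of_real (f i))"
  by (induction A rule: infinite_finite_induct) (simp_all add: map_poly_of_real_mult)

definition squarefree_monomial :: "'v set \<Rightarrow> 'v \<Rightarrow>\<^sub>0 nat" where
  "squarefree_monomial S = (\<Sum>v\<in>S. Poly_Mapping.single v 1)"

lemma lookup_squarefree_monomial:
  "finite S \<Longrightarrow> Poly_Mapping.lookup (squarefree_monomial S) v = (if v \<in> S then 1 else 0)"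
  by (simp add: squarefree_monomial_def lookup_sum lookup_single when_def)

lemma keys_squarefree_monomial:
  "finite S \<Longrightarrow> Poly_Mapping.keys (squarefree_monomial S) = S"
  by (auto simp: in_keys_iff lookup_squarefree_monomial split: if_splits)

lemma prod_mv_var:
  "(\<Prod>v\<in>S. mv_var v) = (Poly_Mapping.single (squarefree_monomial S) 1 :: ('v, real) mv_poly)"
  unfolding squarefree_monomial_def
  by (induction S rule: infinite_finite_induct) (simp_all add: mv_var_def mult_single)

text \<open>Distinct finite sets give distinct squarefree monomials, so no terms merge and every
  coefficient is 1.\<close>

lemma ray_poly_sum_squarefree:
  assumes "finite I" and fin: "\<And>S. S \<in> I \<Longrightarrow> finite S"
  shows "ray_poly (\<Sum>S\<in>I. \<Prod>v\<in>S. mv_var v) t = (\<Sum>S\<in>I. \<Prod>v\<in>S. [:0, t v:])"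
proof -
  let ?m = squarefree_monomial
  define p :: "('a, real) mv_poly" where "p = (\<Sum>S\<in>I. \<Prod>v\<in>S. mv_var v)"
  have inj: "inj_on ?m I"
    by (rule inj_onI) (metis fin keys_squarefree_monomial)
  have lookup: "Poly_Mapping.lookup p m = (\<Sum>S\<in>I. if ?m S = m then 1 else 0)" for m
    by (simp add: p_def prod_mv_var lookup_sum lookup_single when_def)
  have lookup_m: "Poly_Mapping.lookup p (?m S) = 1" if "S \<in> I" for S
  proof -
    have "(\<Sum>T\<in>I. if ?m T = ?m S then 1 else (0::real)) = (\<Sum>T\<in>I. if T = S then 1 else 0)"
      using inj that by (intro sum.cong) (auto dest: inj_onD)
    then show ?thesis using that assms(1) by (simp add: lookup)
  qed
  have "Poly_Mapping.lookup p m = 0" if "m \<notin> ?m ` I" for m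
    unfolding lookup using that by (intro sum.neutral) auto
  then have keys: "Poly_Mapping.keys p = ?m ` I"
    using lookup_m by (fastforce simp: in_keys_iff)
  show ?thesis
    unfolding p_def[symmetric] ray_poly_def keys sum.reindex[OF inj] o_def
    by (intro sum.cong refl)
      (simp add: lookup_m fin keys_squarefree_monomial lookup_squarefree_monomial)
qed

section \<open>Passage to graphs, with claws described by adjacency of four vertices\<close>

text \<open>The right side is the arc set that \<open>complete_bipartite_digraph\<close> prescribes,
  each edge counted in both directions.\<close>

lemma (in sym_irrefl_rel) claw_edges:
  assumes "(v, a) \<in> E" "(v, b) \<in> E" "(v, c) \<in> E" "(a, b) \<notin> E" "(a, c) \<notin> E" "(b, c) \<notin> E"
  shows "{e \<in> E. fst e \<in> {v, a, b, c} \<and> snd e \<in> {v, a, b, c}} = {v} \<times> {a, b, c} \<union> {a, b, c} \<times> {v}"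
    (is "?L = ?R")
proof (rule subset_antisym; rule subrelI)
  have nonrev: "(b, a) \<notin> E" "(c, a) \<notin> E" "(c, b) \<notin> E" using assms(4-6) E_sym by blast+
  fix x y
  show "(x, y) \<in> ?R" if "(x, y) \<in> ?L"
  proof -
    have E: "(x, y) \<in> E" and "x \<in> {v, a, b, c}" "y \<in> {v, a, b, c}" using that by simp_all
    then show ?thesis
      using nonrev assms(4-6) E_irrefl by (elim insertE emptyE) (hypsubst, simp)+
  qed
  show "(x, y) \<in> ?L" if "(x, y) \<in> ?R"
  proof -
    have "(a, v) \<in> E" "(b, v) \<in> E" "(c, v) \<in> E" using assms(1-3) E_sym by blast+
    then show ?thesis using that assms(1-3) by force
  qed
qed

context graph
begin

lemma sym_irrefl_rel_arcs_ends: "sym_irrefl_rel (arcs_ends G)"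
proof
  show "(v, u) \<in> arcs_ends G" if "(u, v) \<in> arcs_ends G" for u v
    using that sym_arcs unfolding symmetric_def by (blast dest: symD)
  show "(v, v) \<notin> arcs_ends G" for v
    using no_loops by (auto simp: arcs_ends_conv)
qed

sublocale sym_irrefl_rel "arcs_ends G" by (rule sym_irrefl_rel_arcs_ends)

lemma poly_ray_poly_independence_poly:
  "poly (map_poly complex_of_real (ray_poly (independence_poly G) t)) z = ipoly t (verts G) z"
proof -
  have I: "{S. independent_set G S} = indep_subsets (verts G)"
    by (auto simp: independent_set_def indep_subsets_def indep_def)
  have "finite (indep_subsets (verts G))" by (simp add: finite_indep_subsets)
  moreover have "finite S" if "S \<in> indep_subsets (verts G)" for S
    using that finite_subset[OF _ finite_verts] by (auto simp: indep_subsets_def)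
  ultimately show ?thesis
    unfolding independence_poly_def I
    by (simp add: ray_poly_sum_squarefree map_poly_of_real_sum map_poly_of_real_prod
        map_poly_pCons poly_sum poly_prod ipoly_def weight_def mult.commute)
qed

lemma claw_free_iff:
  "claw_free G \<longleftrightarrow> (\<forall>v a b c. (v, a) \<in> arcs_ends G \<and> (v, b) \<in> arcs_ends G \<and> (v, c) \<in> arcs_ends G
     \<and> distinct [a, b, c] \<longrightarrow> (a, b) \<in> arcs_ends G \<or> (a, c) \<in> arcs_ends G \<or> (b, c) \<in> arcs_ends G)"
  (is "_ \<longleftrightarrow> ?noclaw")
proof
  assume cf: "claw_free G"
  show ?noclaw
  proof (intro allI impI, elim conjE, rule ccontr)
    fix v a b c
    assume va: "(v, a) \<in> arcs_ends G" and vb: "(v, b) \<in> arcs_ends G" and vc: "(v, c) \<in> arcs_ends G"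
      and dist: "distinct [a, b, c]"
      and non: "\<not> ((a, b) \<in> arcs_ends G \<or> (a, c) \<in> arcs_ends G \<or> (b, c) \<in> arcs_ends G)"
    let ?X = "{v, a, b, c}"
    have X: "?X \<subseteq> verts G" using va vb vc by (auto simp: arcs_ends_conv)
    have ind: "induced_subgraph (G \<restriction> ?X) G" using X by (rule induced_induce)
    have graph_X: "graph (G \<restriction> ?X)"
      using digraphI_induced[OF ind] induced_graph_imp_graph[OF ind]
      by (simp add: graph_def pseudo_graph_def digraph_def)
    have "arcs_ends (G \<restriction> ?X) = {e \<in> arcs_ends G. fst e \<in> ?X \<and> snd e \<in> ?X}"
      by (auto simp: arcs_ends_conv)
    also have "\<dots> = {v} \<times> {a, b, c} \<union> {a, b, c} \<times> {v}"
      using claw_edges[OF va vb vc] non by blast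
    finally have ends: "arcs_ends (G \<restriction> ?X) = {v} \<times> {a, b, c} \<union> {a, b, c} \<times> {v}" .
    have "verts (G \<restriction> ?X) = {v} \<union> {a, b, c}" by auto
    moreover have "{v} \<inter> {a, b, c} = {}" using va vb vc E_irrefl by auto
    moreover have "card {v} = 1" "card {a, b, c} = 3" using dist by simp_all
    ultimately have "K\<^bsub>1,3\<^esub> (G \<restriction> ?X)"
      unfolding complete_bipartite_digraph_def using graph_X ends by blast
    then show False using cf ind unfolding claw_free_def by blast
  qed
next
  assume nc: ?noclaw
  show "claw_free G"
    unfolding claw_free_def
  proof (rule notI, elim exE conjE)
    fix H assume ind: "induced_subgraph H G" and K: "K\<^bsub>1,3\<^esub> H"
    obtain U V where UV: "verts H = U \<union> V" "U \<inter> V = {}" "card U = 1" "card V = 3"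
      "arcs_ends H = U \<times> V \<union> V \<times> U"
      using K unfolding complete_bipartite_digraph_def by auto
    obtain v where v: "U = {v}" using UV(3) by (auto simp: card_1_singleton_iff)
    obtain a b c where abc: "V = {a, b, c}" "distinct [a, b, c]"
      using UV(4) by (auto simp: card_3_iff)
    have ends: "(x, y) \<in> arcs_ends H \<longleftrightarrow> (x, y) \<in> arcs_ends G" if "x \<in> verts H" "y \<in> verts H" for x y
    proof -
      have "tail H = tail G" "head H = head G"
        using ind by (auto simp: induced_subgraph_def subgraph_def compatible_def)
      moreover have "arcs H = {e \<in> arcs G. tail G e \<in> verts H \<and> head G e \<in> verts H}"
        using ind by (simp add: induced_subgraph_def)
      ultimately show ?thesis using that by (auto simp: arcs_ends_conv)
    qed
    have "(v, a) \<in> arcs_ends G" "(v, b) \<in> arcs_ends G" "(v, c) \<in> arcs_ends G"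
      using ends UV v abc by auto
    moreover have "(a, b) \<notin> arcs_ends G" "(a, c) \<notin> arcs_ends G" "(b, c) \<notin> arcs_ends G"
      using ends UV v abc by auto
    ultimately show False using nc abc(2) by blast
  qed
qed

end

section \<open>The cubic of the claw\<close>

lemma nonreal_root_of_claw_poly:
  obtains z :: complex where "z \<notin> \<real>" "(1 + z) ^ 3 + z = 0"
proof -
  have "\<exists>r\<ge>-1. r \<le> 0 \<and> (1 + r) ^ 3 + r = (0::real)"
    by (rule IVT') (auto intro!: continuous_intros)
  then obtain r :: real where r: "(1 + r) ^ 3 + r = 0" by blast
  \<comment> \<open>Dividing the cubic by \<open>z - r\<close> leaves a quadratic whose discriminant
    is \<open>-(7 + 6 * r + 3 * r\<^sup>2)\<close>. It is negative, and \<open>z\<close> below comes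
    from the quadratic formula.\<close>
  have "7 + 6 * r + 3 * r\<^sup>2 = 3 * (r + 1)\<^sup>2 + 4" by (simp add: power2_eq_square algebra_simps)
  then have "0 < 7 + 6 * r + 3 * r\<^sup>2" using zero_le_power2[of "r + 1"] by linarith
  then obtain d where d: "d\<^sup>2 = 7 + 6 * r + 3 * r\<^sup>2" "d \<noteq> 0"
    by (metis less_imp_le less_irrefl power_zero_numeral real_sqrt_pow2)
  define z where "z = Complex (- (3 + r) / 2) (d / 2)"
  have q: "z\<^sup>2 + (3 + of_real r) * z + (4 + 3 * of_real r + (of_real r)\<^sup>2) = 0"
    using d(1) by (simp add: complex_eq_iff z_def power2_eq_square field_simps)
  have "(1 + z) ^ 3 + z = (z - of_real r) * (z\<^sup>2 + (3 + of_real r) * z + (4 + 3 * of_real r + (of_real r)\<^sup>2))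
      + of_real ((1 + r) ^ 3 + r)"
    by (simp add: power2_eq_square power3_eq_cube algebra_simps)
  then have "(1 + z) ^ 3 + z = 0" unfolding q r by simp
  moreover have "z \<notin> \<real>" using d(2) by (simp add: complex_is_Real_iff z_def)
  ultimately show ?thesis using that by blast
qed

text \<open>Zero weights remove every set that leaves the claw. Inside it, the independent sets are
  the subsets of the three leaves, giving \<open>(1 + z) ^ 3\<close>, and the centre alone, giving
  \<open>z\<close>.\<close>

lemma (in sym_irrefl_rel) ipoly_claw:
  assumes "finite U" "{v, a, b, c} \<subseteq> U" and dist: "distinct [a, b, c]"
    and va: "(v, a) \<in> E" and vb: "(v, b) \<in> E" and vc: "(v, c) \<in> E"
    and non: "(a, b) \<notin> E" "(a, c) \<notin> E" "(b, c) \<notin> E"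
  shows "ipoly (indicator {v, a, b, c}) U z = (1 + z) ^ 3 + z"
proof -
  let ?X = "{v, a, b, c}"
  have ne: "v \<notin> {a, b, c}" using va vb vc E_irrefl by auto
  have "ipoly (indicator ?X) U z = (\<Sum>S\<in>indep_subsets ?X. weight (indicator ?X) z S)"
    unfolding ipoly_def
  proof (rule sum.mono_neutral_right)
    show "finite (indep_subsets U)" using assms(1) by (rule finite_indep_subsets)
    show "indep_subsets ?X \<subseteq> indep_subsets U" using assms(2) by (auto simp: indep_subsets_def)
    show "\<forall>S\<in>indep_subsets U - indep_subsets ?X. weight (indicator ?X) z S = 0"
    proof
      fix S assume S: "S \<in> indep_subsets U - indep_subsets ?X"
      then have "finite S" using assms(1) by (auto simp: indep_subsets_def intro: finite_subset)
      moreover have "\<exists>u\<in>S. u \<notin> ?X" using S by (auto simp: indep_subsets_def)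
      ultimately show "weight (indicator ?X) z S = 0"
        by (auto simp: weight_def indicator_def)
    qed
  qed
  also have "\<dots> = (\<Sum>S\<in>indep_subsets ?X. z ^ card S)"
  proof (rule sum.cong[OF refl])
    fix S assume "S \<in> indep_subsets ?X"
    then have "weight (indicator ?X) z S = (\<Prod>u\<in>S. z)"
      unfolding weight_def by (intro prod.cong) (auto simp: indep_subsets_def)
    then show "weight (indicator ?X) z S = z ^ card S" by simp
  qed
  also have "indep_subsets ?X = insert {v} (Pow {a, b, c})"
  proof
    show "indep_subsets ?X \<subseteq> insert {v} (Pow {a, b, c})"
      using va vb vc unfolding indep_subsets_def indep_def by blast
    show "insert {v} (Pow {a, b, c}) \<subseteq> indep_subsets ?X"
      using non E_sym E_irrefl unfolding indep_subsets_def indep_def by blast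
  qed
  also have "(\<Sum>S\<in>insert {v} (Pow {a, b, c}). z ^ card S) = z + (\<Sum>S\<in>Pow {a, b, c}. z ^ card S)"
    using ne by simp
  also have "(\<Sum>S\<in>Pow {a, b, c}. z ^ card S) = (\<Prod>u\<in>{a, b, c}. z + 1)"
    by (subst prod_add) simp_all
  also have "\<dots> = (1 + z) ^ 3" using dist by (simp add: power3_eq_cube mult.assoc add.commute)
  finally show ?thesis by (simp add: add.commute)
qed

theorem corollary3p6:
  fixes G :: "('a, 'b) pre_digraph"
  assumes "graph G"
  shows "same_phase_stable (verts G) (independence_poly G) \<longleftrightarrow> claw_free G"
proof -
  interpret graph G by fact
  show ?thesis
  proof
    assume stable: "same_phase_stable (verts G) (independence_poly G)"
    show "claw_free G"
    proof (rule ccontr)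
      assume "\<not> claw_free G"
      then obtain v a b c where claw:
        "(v, a) \<in> arcs_ends G" "(v, b) \<in> arcs_ends G" "(v, c) \<in> arcs_ends G" "distinct [a, b, c]"
        "(a, b) \<notin> arcs_ends G" "(a, c) \<notin> arcs_ends G" "(b, c) \<notin> arcs_ends G"
        unfolding claw_free_iff by blast
      let ?t = "indicator {v, a, b, c} :: 'a \<Rightarrow> real"
      let ?p = "ray_poly (independence_poly G) ?t"
      have "{v, a, b, c} \<subseteq> verts G" using claw(1-3) by (auto simp: arcs_ends_conv)
      then have p: "poly (map_poly complex_of_real ?p) z = (1 + z) ^ 3 + z" for z
        unfolding poly_ray_poly_independence_poly using claw by (intro ipoly_claw) auto
      \<comment> \<open>The value 1 at 0 rules out the zero polynomial, which counts as real-rooted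
        by convention.\<close>
      have "?p \<noteq> 0" using p[of 0] by auto
      moreover have "real_rooted ?p" using stable by (simp add: same_phase_stable_def)
      ultimately have "z \<in> \<real>" if "(1 + z) ^ 3 + z = 0" for z :: complex
        using that by (simp add: real_rooted_def p)
      then show False using nonreal_root_of_claw_poly by blast
    qed
  next
    assume "claw_free G"
    then interpret claw_free_rel "arcs_ends G"
      by unfold_locales (unfold claw_free_iff, blast)
    show "same_phase_stable (verts G) (independence_poly G)"
      unfolding same_phase_stable_def real_rooted_def poly_ray_poly_independence_poly
      using ipoly_nonzero[OF finite_verts] by blast
  qed
qed

end
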